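(* Let $\alpha>0$ and take exponents $\beta=k=\alpha$, $q=2\alpha$. Let $P_0,R_0,T_0>0$, $\gamma>1$, $0<X<1$ be constants, $s=R_0^3-X+1$, $\rho_0=1/s$, $a_0=R_0^{-3/2}P_0^{1/2}s$. Let $\rho^{(1)}(\xi,\tau)$ be an arbitrary smooth solution of the linear diffusion equation $$\rho^{(1)}_\tau=A\,\rho^{(1)}_{\xi\xi},\qquad A=\frac{\left[\left(P_0^2R_0+\frac43T_0\right)(1-X)+P_0^2R_0^4+\frac{13}{3}R_0^3T_0\right]s}{6R_0^3T_0},$$ let $\rho^{(2)}(\xi,\tau)$ be smooth, and let the remaining smooth functions be determined by $$u^{(1)}=\frac{a_0}{\rho_0}\rho^{(1)},\quad R^{(1)}=-\frac{s^2}{3R_0^2}\rho^{(1)},\quad P_2^{(1)}=-\frac{3P_0}{R_0}R^{(1)},\quad P^{(1)}=P_2^{(1)},$$ $$u^{(2)}_\xi=\frac{a_0}{\rho_0}\rho^{(2)}_\xi-\frac1{\rho_0}\rho^{(1)}_\tau,\quad P^{(2)}=P_2^{(2)}+\frac{4a_0}{3R_0}R^{(1)}_\xi,$$ $$P_2^{(2)}=-\frac{3P_0}{R_0}R^{(2)}+\frac{a_0P_0^2}{T_0}R^{(1)}_\xi,\quad R^{(2)}=-\frac{s^2}{3R_0^2}\rho^{(2)}.$$ Then for the truncated expansions $$\rho=\rho_0+\epsilon^q\rho^{(1)}+\epsilon^{q+k}\rho^{(2)},\quad u=\epsilon^qu^{(1)}+\epsilon^{q+k}u^{(2)},\quad R=R_0+\epsilon^qR^{(1)}+\epsilon^{q+k}R^{(2)},$$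 $$P=P_0+\epsilon^qP^{(1)}+\epsilon^{q+k}P^{(2)},\quad P_2=P_0+\epsilon^qP_2^{(1)}+\epsilon^{q+k}P_2^{(2)}$$ the lowest-order $\epsilon$-dependent terms of the bubbly fluid equations vanish: for each fixed $(\xi,\tau)$, as $\epsilon\to0^+$, the coefficients of $\epsilon^{\alpha+q}$ and $\epsilon^{\alpha+q+k}$ in the residuals $E_1,E_2$ and of $\epsilon^{q}$ and $\epsilon^{q+k}$ in $E_3,E_4,E_5$ are zero, so that $E_1,E_2=O(\epsilon^{5\alpha})$ and $E_3,E_4,E_5=O(\epsilon^{4\alpha})$.
   Context: Residuals of the dimensionless one-dimensional bubbly fluid system (no gravity), with $\mathcal{D}_t=\partial_t+u\partial_x$: $$E_1=\rho_t+(\rho u)_x,\qquad E_2=(\rho u)_t+(\rho u^2+P)_x-u_{xx},$$ $$E_3=P-P_2+R\,\mathcal{D}_t^2R+\tfrac32(\mathcal{D}_tR)^2+\tfrac43\frac{\mathcal{D}_tR}{R},$$ $$E_4=\mathcal{D}_tP_2+3\gamma P_2\frac{\mathcal{D}_tR}{R}+3(\gamma-1)\frac{T_0}{R}\left(\frac{P_2R^3}{P_0R_0^3}-1\right),\qquad E_5=(1-X+R^3)\rho-1.$$ Gardner–Morikawa variables: $\xi=\epsilon^\alpha(x-a_0t)$, $\tau=\epsilon^{\alpha+\beta}t$, so that on functions of $(\xi,\tau)$ one has $\partial_x=\epsilon^\alpha\partial_\xi$, $\partial_t=-a_0\epsilon^\alpha\partial_\xi+\epsilon^{\alpha+\beta}\partial_\tau$.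 All coefficient functions are smooth functions of $(\xi,\tau)\in\mathbb{R}\times J$, $J$ an open interval; subscripts $\xi,\tau$ denote partial derivatives. *)

theory Defs
  imports "HOL-Analysis.Analysis" "HOL-Library.Landau_Symbols"
begin

text \<open>
  Smoothness (class C-infinity) on an open set: all iterated Frechet derivatives exist and are
  continuous. The definition is meant for open \<open>S\<close>, since the derivative is taken at \<open>x\<close> and not
  at \<open>x\<close> within \<open>S\<close>.
\<close>

primrec times_cont_differentiable_on ::
  "nat \<Rightarrow> ('a::real_normed_vector) set \<Rightarrow> ('a \<Rightarrow> 'b::real_normed_vector) \<Rightarrow> bool" where
  "times_cont_differentiable_on 0 S f \<longleftrightarrow> continuous_on S f"
| "times_cont_differentiable_on (Suc n) S f \<longleftrightarrow>
     f differentiable_on S \<and>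
     (\<forall>v. times_cont_differentiable_on n S (\<lambda>x. frechet_derivative f (at x) v))"

definition smooth_on ::
  "('a::real_normed_vector) set \<Rightarrow> ('a \<Rightarrow> 'b::real_normed_vector) \<Rightarrow> bool" where
  "smooth_on S f \<longleftrightarrow> (\<forall>n. times_cont_differentiable_on n S f)"

text \<open>
  Partial derivatives in the first and second argument. They serve both for functions of \<open>(x, t)\<close>
  and for functions of \<open>(\<xi>, \<tau>)\<close>; space is always the first coordinate, time the second.
\<close>

definition pd1 :: "(real \<times> real \<Rightarrow> real) \<Rightarrow> real \<times> real \<Rightarrow> real" where
  "pd1 f = (\<lambda>(a, b). deriv (\<lambda>y. f (y, b)) a)"

definition pd2 :: "(real \<times> real \<Rightarrow> real) \<Rightarrow> real \<times> real \<Rightarrow> real" where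
  "pd2 f = (\<lambda>(a, b). deriv (\<lambda>y. f (a, y)) b)"

definition mat_deriv ::
  "(real \<times> real \<Rightarrow> real) \<Rightarrow> (real \<times> real \<Rightarrow> real) \<Rightarrow> real \<times> real \<Rightarrow> real" where
  "mat_deriv u f = (\<lambda>z. pd2 f z + u z * pd1 f z)"

text \<open>
  Residuals of the bubbly fluid system, for fields of the physical variables \<open>(x, t)\<close>. The bubble
  pressure, usually written \<open>P\<^sub>2\<close>, is called \<open>Pb\<close>.
\<close>

definition residual1 ::
  "(real \<times> real \<Rightarrow> real) \<Rightarrow> (real \<times> real \<Rightarrow> real) \<Rightarrow> real \<times> real \<Rightarrow> real" where
  "residual1 \<rho> u = (\<lambda>z. pd2 \<rho> z + pd1 (\<lambda>y. \<rho> y * u y) z)"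

definition residual2 ::
  "(real \<times> real \<Rightarrow> real) \<Rightarrow> (real \<times> real \<Rightarrow> real) \<Rightarrow> (real \<times> real \<Rightarrow> real) \<Rightarrow> real \<times> real \<Rightarrow> real" where
  "residual2 \<rho> u P = (\<lambda>z. pd2 (\<lambda>y. \<rho> y * u y) z + pd1 (\<lambda>y. \<rho> y * (u y)\<^sup>2 + P y) z - pd1 (pd1 u) z)"

definition residual3 ::
  "(real \<times> real \<Rightarrow> real) \<Rightarrow> (real \<times> real \<Rightarrow> real) \<Rightarrow> (real \<times> real \<Rightarrow> real) \<Rightarrow>
   (real \<times> real \<Rightarrow> real) \<Rightarrow> real \<times> real \<Rightarrow> real" where
  "residual3 u R P Pb = (\<lambda>z.
     P z - Pb z + R z * mat_deriv u (mat_deriv u R) z + 3/2 * (mat_deriv u R z)\<^sup>2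
     + 4/3 * (mat_deriv u R z / R z))"

definition residual4 ::
  "real \<Rightarrow> real \<Rightarrow> real \<Rightarrow> real \<Rightarrow> (real \<times> real \<Rightarrow> real) \<Rightarrow> (real \<times> real \<Rightarrow> real) \<Rightarrow>
   (real \<times> real \<Rightarrow> real) \<Rightarrow> real \<times> real \<Rightarrow> real" where
  "residual4 \<gamma> P0 R0 T0 u R Pb = (\<lambda>z.
     mat_deriv u Pb z + 3 * \<gamma> * Pb z * (mat_deriv u R z / R z)
     + 3 * (\<gamma> - 1) * (T0 / R z) * (Pb z * R z ^ 3 / (P0 * R0 ^ 3) - 1))"

definition residual5 ::
  "real \<Rightarrow> (real \<times> real \<Rightarrow> real) \<Rightarrow> (real \<times> real \<Rightarrow> real) \<Rightarrow> real \<times> real \<Rightarrow> real" where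
  "residual5 X \<rho> R = (\<lambda>z. (1 - X + R z ^ 3) * \<rho> z - 1)"

text \<open>
  The Gardner--Morikawa map \<open>(x, t) \<mapsto> (\<xi>, \<tau>)\<close> and its inverse: keeping \<open>(\<xi>, \<tau>)\<close> fixed as
  \<open>\<epsilon>\<close> tends to \<open>0\<close> means evaluating at the moving point \<open>gm_inv \<alpha> \<beta> a0 \<epsilon> (\<xi>, \<tau>)\<close>.
\<close>

definition gm :: "real \<Rightarrow> real \<Rightarrow> real \<Rightarrow> real \<Rightarrow> real \<times> real \<Rightarrow> real \<times> real" where
  "gm \<alpha> \<beta> a0 \<epsilon> = (\<lambda>(x, t). (\<epsilon> powr \<alpha> * (x - a0 * t), \<epsilon> powr (\<alpha> + \<beta>) * t))"

definition gm_inv :: "real \<Rightarrow> real \<Rightarrow> real \<Rightarrow> real \<Rightarrow> real \<times> real \<Rightarrow> real \<times> real" where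
  "gm_inv \<alpha> \<beta> a0 \<epsilon> = (\<lambda>(\<xi>, \<tau>).
     (\<xi> / \<epsilon> powr \<alpha> + a0 * (\<tau> / \<epsilon> powr (\<alpha> + \<beta>)), \<tau> / \<epsilon> powr (\<alpha> + \<beta>)))"

lemma gm_gm_inv: "\<epsilon> > 0 \<Longrightarrow> gm \<alpha> \<beta> a0 \<epsilon> (gm_inv \<alpha> \<beta> a0 \<epsilon> p) = p"
  by (cases p) (simp add: gm_def gm_inv_def)

lemma gm_inv_gm: "\<epsilon> > 0 \<Longrightarrow> gm_inv \<alpha> \<beta> a0 \<epsilon> (gm \<alpha> \<beta> a0 \<epsilon> z) = z"
  by (cases z) (simp add: gm_def gm_inv_def)

text \<open>
  The truncated expansion \<open>f0 + \<epsilon>\<^sup>q f1 + \<epsilon>\<^sup>q\<^sup>+\<^sup>k f2\<close>, with \<open>f1\<close> and \<open>f2\<close> functions of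
  \<open>(\<xi>, \<tau>)\<close>, as a field of \<open>(x, t)\<close>.
\<close>

definition gm_expansion ::
  "real \<Rightarrow> real \<Rightarrow> real \<Rightarrow> real \<Rightarrow> real \<Rightarrow> real \<Rightarrow> (real \<times> real \<Rightarrow> real) \<Rightarrow> (real \<times> real \<Rightarrow> real) \<Rightarrow>
   real \<Rightarrow> real \<times> real \<Rightarrow> real" where
  "gm_expansion \<alpha> \<beta> a0 q k f0 f1 f2 \<epsilon> = (\<lambda>z.
     f0 + \<epsilon> powr q * f1 (gm \<alpha> \<beta> a0 \<epsilon> z) + \<epsilon> powr (q + k) * f2 (gm \<alpha> \<beta> a0 \<epsilon> z))"

text \<open>
  \<open>f\<close> has the (Poincare) asymptotic expansion in powers of \<open>\<epsilon>\<^sup>\<alpha>\<close> as \<open>\<epsilon>\<close> tends to \<open>0\<close> from the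
  right, and \<open>c p\<close> is the coefficient of \<open>\<epsilon>\<^sup>p\<close> for every exponent \<open>p\<close> in
  \<open>{0, \<alpha>, 2\<alpha>, \<dots>}\<close>. Only these values of \<open>c\<close> matter, and they are determined by \<open>f\<close>.
\<close>

definition has_powr_expansion :: "real \<Rightarrow> (real \<Rightarrow> real) \<Rightarrow> (real \<Rightarrow> real) \<Rightarrow> bool" where
  "has_powr_expansion \<alpha> f c \<longleftrightarrow>
     (\<forall>N. (\<lambda>\<epsilon>. f \<epsilon> - (\<Sum>n<N. c (real n * \<alpha>) * \<epsilon> powr (real n * \<alpha>)))
            \<in> O[at_right 0](\<lambda>\<epsilon>. \<epsilon> powr (real N * \<alpha>)))"

end

theory Submission
  imports Defs
begin

text \<open>
  With \<open>\<delta> = \<epsilon>\<^sup>\<alpha>\<close> the chain rule turns \<open>\<partial>\<^sub>x\<close> into \<open>\<delta> \<partial>\<^sub>\<xi>\<close> and \<open>\<partial>\<^sub>t\<close> into \<open>\<delta>\<^sup>2 \<partial>\<^sub>\<tau> - a0 \<delta> \<partial>\<^sub>\<xi>\<close>, so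
  at a fixed \<open>(\<xi>, \<tau>)\<close> every residual is a polynomial in \<open>\<delta>\<close>, divided by the value of \<open>R\<close> in the
  third and fourth residual. The relations between the coefficient functions make the terms below
  \<open>\<delta>\<^sup>5\<close> (first two residuals) or \<open>\<delta>\<^sup>4\<close> (the others) cancel; the heat equation is needed only for the
  \<open>\<delta>\<^sup>4\<close> term of the second residual. What remains is a power of \<open>\<delta>\<close> times a function with a power
  series at \<open>0\<close>, because \<open>R\<close> tends to \<open>R0 \<noteq> 0\<close>, and a power series in \<open>\<delta>\<close> is an asymptotic
  expansion in powers of \<open>\<epsilon>\<^sup>\<alpha>\<close>.
\<close>

section \<open>Power series as asymptotic expansions\<close>

text \<open>After \<open>N\<close> terms the rest of the series is \<open>x ^ N\<close> times the
  shifted series, which has the same radius of convergence and, being continuous at 0, stays bounded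
  there.\<close>

lemma has_fps_expansion_remainder:
  fixes f :: "'a::{banach,real_normed_field} \<Rightarrow> 'a"
  assumes "f has_fps_expansion F"
  shows "(\<lambda>x. f x - (\<Sum>n<N. fps_nth F n * x ^ n)) \<in> O[nhds 0](\<lambda>x. x ^ N)"
proof -
  let ?S = "fps_shift N F"
  have F: "fps_conv_radius F > 0" "eventually (\<lambda>x. eval_fps F x = f x) (nhds 0)"
    using assms by (auto simp: has_fps_expansion_def)
  have "eventually (\<lambda>x. x \<in> eball 0 (fps_conv_radius F)) (nhds 0)"
    using F(1) by (intro eventually_nhds_in_open) (auto simp: zero_ereal_def)
  then have "eventually (\<lambda>x. f x - (\<Sum>n<N. fps_nth F n * x ^ n) = eval_fps ?S x * x ^ N) (nhds 0)"
    using F(2)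
  proof eventually_elim
    case (elim x)
    have *: "summable (\<lambda>n. fps_nth F n * x ^ n)"
      using elim by (intro summable_fps) (auto simp: eball_def)
    have **: "summable (\<lambda>n. fps_nth ?S n * x ^ n)"
      using elim by (intro summable_fps) (auto simp: eball_def)
    have "f x = (\<Sum>n. fps_nth F n * x ^ n)"
      using elim by (simp add: eval_fps_def)
    also have "\<dots> = (\<Sum>n. fps_nth F (n + N) * x ^ (n + N)) + (\<Sum>n<N. fps_nth F n * x ^ n)"
      by (rule suminf_split_initial_segment[OF *])
    also have "(\<Sum>n. fps_nth F (n + N) * x ^ (n + N)) = (\<Sum>n. (fps_nth ?S n * x ^ n) * x ^ N)"
      by (simp add: power_add mult.assoc)
    also have "\<dots> = eval_fps ?S x * x ^ N"
      unfolding eval_fps_def by (rule suminf_mult2[OF **, symmetric])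
    finally show ?case by simp
  qed
  moreover have "(\<lambda>x. eval_fps ?S x * x ^ N) \<in> O[nhds 0](\<lambda>x. x ^ N)"
  proof -
    have "isCont (eval_fps ?S) 0"
      using F(1) by (intro continuous_eval_fps) (auto simp: zero_ereal_def)
    then have "(eval_fps ?S \<longlongrightarrow> eval_fps ?S 0) (nhds 0)"
      by (simp add: isCont_def tendsto_nhds_iff)
    then have "eval_fps ?S \<in> O[nhds 0](\<lambda>_. 1)"
      by (intro bigoI_tendsto[where c = "eval_fps ?S 0"]) auto
    from landau_o.big.mult[OF this landau_o.big_refl[where f = "\<lambda>x. x ^ N"]] show ?thesis
      by simp
  qed
  ultimately show ?thesis
    by (simp cong: landau_o.big.in_cong)
qed

text \<open>Coefficients are indexed by exponents here: at an exponent n\<alpha> the quotient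
  \<open>p / \<alpha>\<close> is exactly n, and the floor merely gives a value at all other
  exponents.\<close>

lemma has_powr_expansion_fps:
  assumes \<alpha>: "\<alpha> > 0" and F: "F has_fps_expansion G"
    and E: "eventually (\<lambda>\<epsilon>. E \<epsilon> = F (\<epsilon> powr \<alpha>)) (at_right 0)"
  shows "has_powr_expansion \<alpha> E (\<lambda>p. fps_nth G (nat \<lfloor>p / \<alpha>\<rfloor>))"
  unfolding has_powr_expansion_def
proof
  fix N
  have lim: "filterlim (\<lambda>\<epsilon>. \<epsilon> powr \<alpha>) (nhds 0) (at_right 0)"
    using \<alpha>
    by (intro tendsto_zero_powrI[OF tendsto_ident_at tendsto_const]
        eventually_mono[OF eventually_at_right_less]) auto
  have pow: "\<epsilon> powr (real n * \<alpha>) = (\<epsilon> powr \<alpha>) ^ n" if "\<epsilon> > 0" for \<epsilon> n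
    using that by (simp add: powr_powr mult.commute flip: powr_realpow)
  have pos: "eventually (\<lambda>\<epsilon>. \<epsilon> > (0::real)) (at_right 0)"
    by (rule eventually_at_right_less)
  have "(\<lambda>\<epsilon>. F (\<epsilon> powr \<alpha>) - (\<Sum>n<N. fps_nth G n * (\<epsilon> powr \<alpha>) ^ n))
          \<in> O[at_right 0](\<lambda>\<epsilon>. (\<epsilon> powr \<alpha>) ^ N)"
    by (rule landau_o.big.compose[OF has_fps_expansion_remainder[OF F] lim])
  also have "(\<lambda>\<epsilon>. (\<epsilon> powr \<alpha>) ^ N) \<in> \<Theta>[at_right 0](\<lambda>\<epsilon>. \<epsilon> powr (real N * \<alpha>))"
    by (intro bigthetaI_cong eventually_mono[OF pos]) (simp add: pow)
  finally have *: "(\<lambda>\<epsilon>. F (\<epsilon> powr \<alpha>) - (\<Sum>n<N. fps_nth G n * (\<epsilon> powr \<alpha>) ^ n))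
          \<in> O[at_right 0](\<lambda>\<epsilon>. \<epsilon> powr (real N * \<alpha>))" .
  show "(\<lambda>\<epsilon>. E \<epsilon> - (\<Sum>n<N. fps_nth G (nat \<lfloor>real n * \<alpha> / \<alpha>\<rfloor>) * \<epsilon> powr (real n * \<alpha>)))
          \<in> O[at_right 0](\<lambda>\<epsilon>. \<epsilon> powr (real N * \<alpha>))"
  proof (rule landau_o.big.in_cong[THEN iffD2, OF _ *])
    show "eventually (\<lambda>\<epsilon>. E \<epsilon> - (\<Sum>n<N. fps_nth G (nat \<lfloor>real n * \<alpha> / \<alpha>\<rfloor>) * \<epsilon> powr (real n * \<alpha>))
             = F (\<epsilon> powr \<alpha>) - (\<Sum>n<N. fps_nth G n * (\<epsilon> powr \<alpha>) ^ n)) (at_right 0)"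
      using pos E by eventually_elim (use \<alpha> in \<open>simp add: pow\<close>)
  qed
qed

text \<open>The form to which all five residuals are brought. The growth bound is the expansion
  stopped at \<open>N = m\<close>, where every subtracted term is zero.\<close>

lemma has_powr_expansion_leading_zeros:
  assumes \<alpha>: "\<alpha> > 0" and h: "h has_fps_expansion H"
    and E: "eventually (\<lambda>\<epsilon>. E \<epsilon> = (\<epsilon> powr \<alpha>) ^ m * h (\<epsilon> powr \<alpha>)) (at_right 0)"
  obtains c where "has_powr_expansion \<alpha> E c" "\<And>n. n < m \<Longrightarrow> c (real n * \<alpha>) = 0"
    "E \<in> O[at_right 0](\<lambda>\<epsilon>. \<epsilon> powr (real m * \<alpha>))"
proof -
  define c where "c = (\<lambda>p. fps_nth (fps_X ^ m * H) (nat \<lfloor>p / \<alpha>\<rfloor>))"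
  have c: "has_powr_expansion \<alpha> E c"
    unfolding c_def
    by (rule has_powr_expansion_fps[OF \<alpha> has_fps_expansion_mult[OF has_fps_expansion_fps_X_power h] E])
  have zero: "c (real n * \<alpha>) = 0" if "n < m" for n
    using that \<alpha> by (simp add: c_def fps_X_power_mult_nth)
  then have "E \<in> O[at_right 0](\<lambda>\<epsilon>. \<epsilon> powr (real m * \<alpha>))"
    using c[unfolded has_powr_expansion_def, rule_format, of m] by simp
  with c zero show thesis by (rule that)
qed

section \<open>Partial derivatives\<close>

lemma pd_has_derivative:
  assumes "(f has_derivative f') (at p)"
  shows "pd1 f p = f' (1, 0)" and "pd2 f p = f' (0, 1)"
proof -
  obtain a b where p: "p = (a, b)" by (cases p)
  have L: "linear f'" using assms by (rule has_derivative_linear)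
  have "((\<lambda>y. f (y, b)) has_derivative (\<lambda>y. f' (y, 0))) (at a)"
    using assms unfolding p
    by (rule has_derivative_compose[rotated]) (rule has_derivative_Pair[OF has_derivative_ident has_derivative_const])
  moreover have "(\<lambda>y. f' (y, 0)) = (*) (f' (1, 0))"
  proof
    show "f' (y, 0) = f' (1, 0) * y" for y
      using linear_scale[OF L, of y "(1, 0)"] by simp
  qed
  ultimately show "pd1 f p = f' (1, 0)"
    by (simp add: p pd1_def DERIV_imp_deriv has_field_derivative_def)
  have "((\<lambda>y. f (a, y)) has_derivative (\<lambda>y. f' (0, y))) (at b)"
    using assms unfolding p
    by (rule has_derivative_compose[rotated]) (rule has_derivative_Pair[OF has_derivative_const has_derivative_ident])
  moreover have "(\<lambda>y. f' (0, y)) = (*) (f' (0, 1))"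
  proof
    show "f' (0, y) = f' (0, 1) * y" for y
      using linear_scale[OF L, of y "(0, 1)"] by simp
  qed
  ultimately show "pd2 f p = f' (0, 1)"
    by (simp add: p pd2_def DERIV_imp_deriv has_field_derivative_def)
qed

text \<open>A linear map on the plane is determined by its values at the two unit vectors.
  Differentiability is assumed because partial derivatives alone do not yield it.\<close>

lemma has_derivative_pd:
  assumes "f differentiable (at p)"
  shows "(f has_derivative (\<lambda>(x, y). pd1 f p * x + pd2 f p * y)) (at p)"
proof -
  obtain f' where f': "(f has_derivative f') (at p)"
    using assms by (auto simp: differentiable_def)
  have L: "linear f'" using f' by (rule has_derivative_linear)
  have "f' (x, y) = pd1 f p * x + pd2 f p * y" for x y
    using linear_add[OF L, of "x *\<^sub>R (1, 0)" "y *\<^sub>R (0, 1)"]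
      linear_scale[OF L, of x "(1, 0)"] linear_scale[OF L, of y "(0, 1)"]
    by (simp add: pd_has_derivative[OF f'] mult.commute)
  then have "f' = (\<lambda>(x, y). pd1 f p * x + pd2 f p * y)" by auto
  with f' show ?thesis by simp
qed

lemma pd_const [simp]: "pd1 (\<lambda>_. c) p = 0" "pd2 (\<lambda>_. c) p = 0"
  by (rule pd_has_derivative[OF has_derivative_const])+

lemma
  assumes "f differentiable (at p)" "g differentiable (at p)"
  shows pd1_add: "pd1 (\<lambda>z. f z + g z) p = pd1 f p + pd1 g p"
    and pd2_add: "pd2 (\<lambda>z. f z + g z) p = pd2 f p + pd2 g p"
    and pd1_diff: "pd1 (\<lambda>z. f z - g z) p = pd1 f p - pd1 g p"
    and pd2_diff: "pd2 (\<lambda>z. f z - g z) p = pd2 f p - pd2 g p"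
    and pd1_mult: "pd1 (\<lambda>z. f z * g z) p = pd1 f p * g p + f p * pd1 g p"
    and pd2_mult: "pd2 (\<lambda>z. f z * g z) p = pd2 f p * g p + f p * pd2 g p"
proof -
  note D = assms[THEN has_derivative_pd]
  show "pd1 (\<lambda>z. f z + g z) p = pd1 f p + pd1 g p"
    and "pd2 (\<lambda>z. f z + g z) p = pd2 f p + pd2 g p"
    unfolding pd_has_derivative[OF has_derivative_add[OF D]] by simp_all
  show "pd1 (\<lambda>z. f z - g z) p = pd1 f p - pd1 g p"
    and "pd2 (\<lambda>z. f z - g z) p = pd2 f p - pd2 g p"
    unfolding pd_has_derivative[OF has_derivative_diff[OF D]] by simp_all
  show "pd1 (\<lambda>z. f z * g z) p = pd1 f p * g p + f p * pd1 g p"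
    and "pd2 (\<lambda>z. f z * g z) p = pd2 f p * g p + f p * pd2 g p"
    unfolding pd_has_derivative[OF has_derivative_mult[OF D]] by simp_all
qed

text \<open>The relations between coefficient functions hold only over \<open>J\<close>, but
  differentiating at a point uses only nearby values.\<close>

lemma pd_cong_open:
  assumes "open S" "p \<in> S" "\<And>z. z \<in> S \<Longrightarrow> f z = g z" "g differentiable (at p)"
  shows "f differentiable (at p)" "pd1 f p = pd1 g p" "pd2 f p = pd2 g p"
proof -
  have f: "(f has_derivative (\<lambda>(x, y). pd1 g p * x + pd2 g p * y)) (at p)"
    by (rule has_derivative_transform_within_open[OF has_derivative_pd[OF assms(4)] assms(1,2)])
       (simp add: assms(3))
  then show "f differentiable (at p)" by (auto simp: differentiable_def)
  show "pd1 f p = pd1 g p" "pd2 f p = pd2 g p"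
    by (simp_all add: pd_has_derivative[OF f])
qed

lemma
  assumes "open S" "p \<in> S" "\<And>z. z \<in> S \<Longrightarrow> f z = c * g z" "g differentiable (at p)"
  shows pd1_cmult_open: "pd1 f p = c * pd1 g p" and pd2_cmult_open: "pd2 f p = c * pd2 g p"
proof -
  have d: "(\<lambda>z. c * g z) differentiable (at p)" using assms(4) by simp
  show "pd1 f p = c * pd1 g p" "pd2 f p = c * pd2 g p"
    using pd_cong_open[OF assms(1-3) d] assms(4) by (simp_all add: pd1_mult pd2_mult)
qed

lemma pd1_lincomb_open:
  assumes "open S" "p \<in> S" "\<And>z. z \<in> S \<Longrightarrow> f z = c * g z + d * h z"
    and gh: "g differentiable (at p)" "h differentiable (at p)"
  shows "pd1 f p = c * pd1 g p + d * pd1 h p"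
proof -
  have "(\<lambda>z. c * g z + d * h z) differentiable (at p)" using gh by simp
  from pd_cong_open(2)[OF assms(1-3) this] show ?thesis
    using gh by (simp add: pd1_add pd1_mult)
qed

text \<open>Smoothness speaks of Frechet derivatives in fixed directions; on \<open>S\<close> those
  along (1, 0) and (0, 1) coincide with the partial derivatives and pass on their
  differentiability.\<close>

lemma smooth_on_imp_differentiable:
  assumes "smooth_on S f" "open S" "p \<in> S"
  shows "f differentiable (at p)" "pd1 f differentiable (at p)" "pd2 f differentiable (at p)"
proof -
  have f2: "times_cont_differentiable_on (Suc (Suc 0)) S f"
    using assms by (auto simp: smooth_on_def)
  have f: "f differentiable (at z)" if "z \<in> S" for z
    using f2 that \<open>open S\<close> by (auto simp: differentiable_on_eq_differentiable_at)
  show "f differentiable (at p)" using f assms by simp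
  have D: "(\<lambda>x. frechet_derivative f (at x) v) differentiable (at p)" for v
    using f2 assms(2,3) by (simp del: split_paired_All add: differentiable_on_eq_differentiable_at)
  show "pd1 f differentiable (at p)"
    by (rule pd_cong_open(1)[OF \<open>open S\<close> \<open>p \<in> S\<close> _ D[of "(1, 0)"]])
       (rule pd_has_derivative(1)[OF frechet_derivative_works[THEN iffD1, OF f]])
  show "pd2 f differentiable (at p)"
    by (rule pd_cong_open(1)[OF \<open>open S\<close> \<open>p \<in> S\<close> _ D[of "(0, 1)"]])
       (rule pd_has_derivative(2)[OF frechet_derivative_works[THEN iffD1, OF f]])
qed

lemma continuous_on_gm: "continuous_on UNIV (gm \<alpha> \<beta> a0 \<epsilon>)"
  unfolding gm_def case_prod_beta by (intro continuous_intros)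

text \<open>Chain rule. It suffices that \<open>f\<close> factors through \<open>gm\<close> over
  \<open>S\<close>, since the preimage of \<open>S\<close> is an open neighbourhood of
  \<open>z\<close>; the formula for material derivatives is available only there.\<close>

lemma pd_gm:
  assumes "open S" "gm \<alpha> \<beta> a0 \<epsilon> z \<in> S" "\<And>w. gm \<alpha> \<beta> a0 \<epsilon> w \<in> S \<Longrightarrow> f w = \<phi> (gm \<alpha> \<beta> a0 \<epsilon> w)"
    and \<phi>: "\<phi> differentiable (at (gm \<alpha> \<beta> a0 \<epsilon> z))"
  shows "pd1 f z = \<epsilon> powr \<alpha> * pd1 \<phi> (gm \<alpha> \<beta> a0 \<epsilon> z)"
    and "pd2 f z = - a0 * \<epsilon> powr \<alpha> * pd1 \<phi> (gm \<alpha> \<beta> a0 \<epsilon> z)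
                     + \<epsilon> powr (\<alpha> + \<beta>) * pd2 \<phi> (gm \<alpha> \<beta> a0 \<epsilon> z)"
proof -
  let ?G = "gm \<alpha> \<beta> a0 \<epsilon>"
  have "(?G has_derivative (\<lambda>(x, t). (\<epsilon> powr \<alpha> * (x - a0 * t), \<epsilon> powr (\<alpha> + \<beta>) * t))) (at z)"
    unfolding gm_def case_prod_beta by (auto intro!: derivative_eq_intros)
  from has_derivative_compose[OF this has_derivative_pd[OF \<phi>]]
  have "((\<lambda>w. \<phi> (?G w)) has_derivative (\<lambda>(x, t). pd1 \<phi> (?G z) * (\<epsilon> powr \<alpha> * (x - a0 * t))
          + pd2 \<phi> (?G z) * (\<epsilon> powr (\<alpha> + \<beta>) * t))) (at z)"
    unfolding case_prod_beta by simp
  then have f: "(f has_derivative (\<lambda>(x, t). pd1 \<phi> (?G z) * (\<epsilon> powr \<alpha> * (x - a0 * t))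
          + pd2 \<phi> (?G z) * (\<epsilon> powr (\<alpha> + \<beta>) * t))) (at z)"
    by (rule has_derivative_transform_within_open[where s = "?G -` S"])
       (use assms continuous_on_gm in \<open>auto intro: open_vimage\<close>)
  show "pd1 f z = \<epsilon> powr \<alpha> * pd1 \<phi> (?G z)"
    and "pd2 f z = - a0 * \<epsilon> powr \<alpha> * pd1 \<phi> (?G z) + \<epsilon> powr (\<alpha> + \<beta>) * pd2 \<phi> (?G z)"
    by (simp_all add: pd_has_derivative[OF f])
qed

section \<open>Residuals in the slow variables\<close>

text \<open>The truncated expansion in the slow variables, with \<delta> for \<epsilon>^\<alpha>:
  the exponents q = 2\<alpha> and q + k = 3\<alpha> become the powers 2 and 3.\<close>

definition slow :: "real \<Rightarrow> (real \<times> real \<Rightarrow> real) \<Rightarrow> (real \<times> real \<Rightarrow> real) \<Rightarrow> real \<Rightarrow> real \<times> real \<Rightarrow> real" where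
  "slow f0 f1 f2 \<delta> = (\<lambda>p. f0 + \<delta>\<^sup>2 * f1 p + \<delta> ^ 3 * f2 p)"

lemma gm_expansion_eq_slow:
  "gm_expansion \<alpha> \<beta> a0 (2 * \<alpha>) \<alpha> f0 f1 f2 \<epsilon> z
    = slow f0 f1 f2 (\<epsilon> powr \<alpha>) (gm \<alpha> \<beta> a0 \<epsilon> z)"
proof -
  have *: "\<epsilon> powr (2 * \<alpha>) = (\<epsilon> powr \<alpha>)\<^sup>2" "\<epsilon> powr (2 * \<alpha> + \<alpha>) = (\<epsilon> powr \<alpha>) ^ 3"
    unfolding mult_2 powr_add power2_eq_square power3_eq_cube by (rule refl)+
  show ?thesis unfolding gm_expansion_def slow_def * by (rule refl)
qed

lemma
  assumes "f1 differentiable (at p)" "f2 differentiable (at p)"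
  shows differentiable_slow: "slow f0 f1 f2 \<delta> differentiable (at p)"
    and pd1_slow: "pd1 (slow f0 f1 f2 \<delta>) p = slow 0 (pd1 f1) (pd1 f2) \<delta> p"
    and pd2_slow: "pd2 (slow f0 f1 f2 \<delta>) p = slow 0 (pd2 f1) (pd2 f2) \<delta> p"
  using assms unfolding slow_def by (simp_all add: pd1_add pd2_add pd1_mult pd2_mult)

text \<open>The material derivative of an expansion divided by \<delta>^3: the perturbation supplies
  \<delta>^2 and the differentiation one more \<delta>.\<close>

definition slow_mat_deriv :: "real \<Rightarrow> real \<Rightarrow> (real \<times> real \<Rightarrow> real) \<Rightarrow> (real \<times> real \<Rightarrow> real) \<Rightarrow>
    (real \<times> real \<Rightarrow> real) \<Rightarrow> (real \<times> real \<Rightarrow> real) \<Rightarrow> real \<times> real \<Rightarrow> real" where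
  "slow_mat_deriv a0 \<delta> u1 u2 f1 f2 = (\<lambda>p.
     (\<delta>\<^sup>2 * (u1 p + \<delta> * u2 p) - a0) * (pd1 f1 p + \<delta> * pd1 f2 p) + \<delta> * (pd2 f1 p + \<delta> * pd2 f2 p))"

text \<open>\<open>pd\<close> stands for \<open>pd1\<close> or \<open>pd2\<close>; the result is that partial derivative of \<open>slow_mat_deriv\<close>.\<close>

definition slow_mat_deriv_pd :: "real \<Rightarrow> real \<Rightarrow> (real \<times> real \<Rightarrow> real) \<Rightarrow> (real \<times> real \<Rightarrow> real) \<Rightarrow>
    (real \<times> real \<Rightarrow> real) \<Rightarrow> (real \<times> real \<Rightarrow> real) \<Rightarrow> real \<times> real \<Rightarrow>
    ((real \<times> real \<Rightarrow> real) \<Rightarrow> real \<times> real \<Rightarrow> real) \<Rightarrow> real" where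
  "slow_mat_deriv_pd a0 \<delta> u1 u2 f1 f2 p pd =
     \<delta>\<^sup>2 * (pd u1 p + \<delta> * pd u2 p) * (pd1 f1 p + \<delta> * pd1 f2 p)
     + (\<delta>\<^sup>2 * (u1 p + \<delta> * u2 p) - a0) * (pd (pd1 f1) p + \<delta> * pd (pd1 f2) p)
     + \<delta> * (pd (pd2 f1) p + \<delta> * pd (pd2 f2) p)"

definition slow_mat_deriv2 :: "real \<Rightarrow> real \<Rightarrow> (real \<times> real \<Rightarrow> real) \<Rightarrow> (real \<times> real \<Rightarrow> real) \<Rightarrow>
    (real \<times> real \<Rightarrow> real) \<Rightarrow> (real \<times> real \<Rightarrow> real) \<Rightarrow> real \<times> real \<Rightarrow> real" where
  "slow_mat_deriv2 a0 \<delta> u1 u2 f1 f2 p =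
     (\<delta>\<^sup>2 * (u1 p + \<delta> * u2 p) - a0) * slow_mat_deriv_pd a0 \<delta> u1 u2 f1 f2 p pd1
     + \<delta> * slow_mat_deriv_pd a0 \<delta> u1 u2 f1 f2 p pd2"

text \<open>Residuals are evaluated at the physical point \<open>z\<close> over the fixed
  \<open>p\<close>, with \<beta> = k = \<alpha> and q = 2\<alpha> already inserted.\<close>

context
  fixes S :: "(real \<times> real) set" and \<alpha> \<epsilon> a0 \<delta> :: real and p z :: "real \<times> real"
    and ex :: "real \<Rightarrow> (real \<times> real \<Rightarrow> real) \<Rightarrow> (real \<times> real \<Rightarrow> real) \<Rightarrow> real \<times> real \<Rightarrow> real"
  assumes S: "open S" "p \<in> S" and \<epsilon>: "\<epsilon> > 0"
  defines "\<delta> \<equiv> \<epsilon> powr \<alpha>" and "z \<equiv> gm_inv \<alpha> \<alpha> a0 \<epsilon> p"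
    and "ex \<equiv> \<lambda>f0 f1 f2. gm_expansion \<alpha> \<alpha> a0 (2 * \<alpha>) \<alpha> f0 f1 f2 \<epsilon>"
begin

lemma gm_z: "gm \<alpha> \<alpha> a0 \<epsilon> z = p"
  using \<epsilon> by (simp add: z_def gm_gm_inv)

lemma ex_eq_slow: "ex f0 f1 f2 w = slow f0 f1 f2 \<delta> (gm \<alpha> \<alpha> a0 \<epsilon> w)"
  by (simp add: ex_def \<delta>_def gm_expansion_eq_slow)

lemma \<delta>_square: "\<epsilon> powr (2 * \<alpha>) = \<delta>\<^sup>2"
  unfolding mult_2 powr_add power2_eq_square \<delta>_def by (rule refl)

lemma pd_z:
  assumes "\<And>w. gm \<alpha> \<alpha> a0 \<epsilon> w \<in> S \<Longrightarrow> f w = \<phi> (gm \<alpha> \<alpha> a0 \<epsilon> w)" "\<phi> differentiable (at p)"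
  shows "pd1 f z = \<delta> * pd1 \<phi> p" "pd2 f z = \<delta>\<^sup>2 * pd2 \<phi> p - a0 * \<delta> * pd1 \<phi> p"
  using pd_gm[of S \<alpha> \<alpha> a0 \<epsilon> z f \<phi>] assms S
  by (simp_all add: gm_z \<delta>_square flip: \<delta>_def)

lemma pd_ex:
  assumes "smooth_on S f1" "smooth_on S f2" "gm \<alpha> \<alpha> a0 \<epsilon> w \<in> S"
  shows "pd1 (ex f0 f1 f2) w = \<delta> * slow 0 (pd1 f1) (pd1 f2) \<delta> (gm \<alpha> \<alpha> a0 \<epsilon> w)"
    and "pd2 (ex f0 f1 f2) w = \<delta>\<^sup>2 * slow 0 (pd2 f1) (pd2 f2) \<delta> (gm \<alpha> \<alpha> a0 \<epsilon> w)
           - a0 * \<delta> * slow 0 (pd1 f1) (pd1 f2) \<delta> (gm \<alpha> \<alpha> a0 \<epsilon> w)"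
  using pd_gm[OF S(1) assms(3), of "ex f0 f1 f2" "slow f0 f1 f2 \<delta>"]
    assms(1,2)[THEN smooth_on_imp_differentiable(1), OF S(1) assms(3)]
  by (simp_all add: ex_eq_slow differentiable_slow pd1_slow pd2_slow \<delta>_square flip: \<delta>_def)

text \<open>Stated at every \<open>w\<close> over \<open>S\<close>, not only at \<open>z\<close>,
  because the second material derivative differentiates this formula again.\<close>

lemma mat_deriv_ex:
  assumes "smooth_on S f1" "smooth_on S f2" "gm \<alpha> \<alpha> a0 \<epsilon> w \<in> S"
  shows "mat_deriv (ex 0 u1 u2) (ex f0 f1 f2) w
           = \<delta> ^ 3 * slow_mat_deriv a0 \<delta> u1 u2 f1 f2 (gm \<alpha> \<alpha> a0 \<epsilon> w)"
  unfolding mat_deriv_def pd_ex[OF assms] ex_eq_slow slow_mat_deriv_def slow_def by algebra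

text \<open>Products of two perturbations start at \<delta>^5, so the two lower brackets are linear;
  the relations for \<open>u1\<close> and \<open>u2\<close> will annihilate them.\<close>

lemma residual1_ex:
  assumes "smooth_on S \<rho>1" "smooth_on S \<rho>2" "smooth_on S u1" "smooth_on S u2"
  shows "residual1 (ex \<rho>0 \<rho>1 \<rho>2) (ex 0 u1 u2) z =
    \<delta> ^ 3 * (\<rho>0 * pd1 u1 p - a0 * pd1 \<rho>1 p)
    + \<delta> ^ 4 * (\<rho>0 * pd1 u2 p - a0 * pd1 \<rho>2 p + pd2 \<rho>1 p)
    + \<delta> ^ 5 * (pd2 \<rho>2 p + (pd1 \<rho>1 p + \<delta> * pd1 \<rho>2 p) * (u1 p + \<delta> * u2 p)
      + (\<rho>1 p + \<delta> * \<rho>2 p) * (pd1 u1 p + \<delta> * pd1 u2 p))"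
proof -
  note d = assms[THEN smooth_on_imp_differentiable(1), OF S]
  have "pd1 (\<lambda>y. ex \<rho>0 \<rho>1 \<rho>2 y * ex 0 u1 u2 y) z
      = \<delta> * pd1 (\<lambda>q. slow \<rho>0 \<rho>1 \<rho>2 \<delta> q * slow 0 u1 u2 \<delta> q) p"
    by (rule pd_z) (simp_all add: ex_eq_slow differentiable_slow d)
  then have "residual1 (ex \<rho>0 \<rho>1 \<rho>2) (ex 0 u1 u2) z =
      \<delta>\<^sup>2 * slow 0 (pd2 \<rho>1) (pd2 \<rho>2) \<delta> p - a0 * \<delta> * slow 0 (pd1 \<rho>1) (pd1 \<rho>2) \<delta> p
      + \<delta> * (slow 0 (pd1 \<rho>1) (pd1 \<rho>2) \<delta> p * slow 0 u1 u2 \<delta> p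
          + slow \<rho>0 \<rho>1 \<rho>2 \<delta> p * slow 0 (pd1 u1) (pd1 u2) \<delta> p)"
    using pd_ex(2)[OF assms(1,2), of z \<rho>0] S
    by (simp add: residual1_def gm_z pd1_mult pd1_slow d differentiable_slow)
  then show ?thesis unfolding slow_def by algebra
qed

text \<open>Viscosity first acts at \<delta>^4, since two space derivatives add \<delta>^2 to the
  \<delta>^2 of the velocity.\<close>

lemma residual2_ex:
  assumes "smooth_on S \<rho>1" "smooth_on S \<rho>2" "smooth_on S u1" "smooth_on S u2"
    "smooth_on S P1" "smooth_on S P2"
  defines "r \<equiv> \<rho>1 p + \<delta> * \<rho>2 p" and "rx \<equiv> pd1 \<rho>1 p + \<delta> * pd1 \<rho>2 p"
    and "rt \<equiv> pd2 \<rho>1 p + \<delta> * pd2 \<rho>2 p" and "v \<equiv> u1 p + \<delta> * u2 p"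
    and "vx \<equiv> pd1 u1 p + \<delta> * pd1 u2 p" and "vt \<equiv> pd2 u1 p + \<delta> * pd2 u2 p"
  shows "residual2 (ex \<rho>0 \<rho>1 \<rho>2) (ex 0 u1 u2) (ex P0 P1 P2) z =
    \<delta> ^ 3 * (pd1 P1 p - a0 * \<rho>0 * pd1 u1 p)
    + \<delta> ^ 4 * (pd1 P2 p - a0 * \<rho>0 * pd1 u2 p + \<rho>0 * pd2 u1 p - pd1 (pd1 u1) p)
    + \<delta> ^ 5 * (\<rho>0 * pd2 u2 p - pd1 (pd1 u2) p - a0 * (rx * v + r * vx)
      + \<delta> * (rt * v + r * vt) + \<delta>\<^sup>2 * rx * (v * v) + 2 * (\<rho>0 + \<delta>\<^sup>2 * r) * v * vx)"
proof -
  note d = assms(1-6)[THEN smooth_on_imp_differentiable(1), OF S]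
  note dx = assms(1-6)[THEN smooth_on_imp_differentiable(2), OF S]
  have m: "pd1 (\<lambda>y. ex \<rho>0 \<rho>1 \<rho>2 y * (ex 0 u1 u2 y)\<^sup>2 + ex P0 P1 P2 y) z
      = \<delta> * pd1 (\<lambda>q. slow \<rho>0 \<rho>1 \<rho>2 \<delta> q * (slow 0 u1 u2 \<delta> q * slow 0 u1 u2 \<delta> q) + slow P0 P1 P2 \<delta> q) p"
    by (rule pd_z) (simp_all add: ex_eq_slow differentiable_slow d power2_eq_square)
  have t: "pd2 (\<lambda>y. ex \<rho>0 \<rho>1 \<rho>2 y * ex 0 u1 u2 y) z
      = \<delta>\<^sup>2 * pd2 (\<lambda>q. slow \<rho>0 \<rho>1 \<rho>2 \<delta> q * slow 0 u1 u2 \<delta> q) p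
       - a0 * \<delta> * pd1 (\<lambda>q. slow \<rho>0 \<rho>1 \<rho>2 \<delta> q * slow 0 u1 u2 \<delta> q) p"
    by (rule pd_z) (simp_all add: ex_eq_slow differentiable_slow d)
  have xx: "pd1 (pd1 (ex 0 u1 u2)) z
      = \<delta> * pd1 (\<lambda>q. \<delta> * slow 0 (pd1 u1) (pd1 u2) \<delta> q) p"
    by (rule pd_z) (simp_all add: pd_ex assms(3,4) differentiable_slow dx)
  have "residual2 (ex \<rho>0 \<rho>1 \<rho>2) (ex 0 u1 u2) (ex P0 P1 P2) z =
      \<delta>\<^sup>2 * (slow 0 (pd2 \<rho>1) (pd2 \<rho>2) \<delta> p * slow 0 u1 u2 \<delta> p
          + slow \<rho>0 \<rho>1 \<rho>2 \<delta> p * slow 0 (pd2 u1) (pd2 u2) \<delta> p)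
      - a0 * \<delta> * (slow 0 (pd1 \<rho>1) (pd1 \<rho>2) \<delta> p * slow 0 u1 u2 \<delta> p
          + slow \<rho>0 \<rho>1 \<rho>2 \<delta> p * slow 0 (pd1 u1) (pd1 u2) \<delta> p)
      + \<delta> * (slow 0 (pd1 \<rho>1) (pd1 \<rho>2) \<delta> p * (slow 0 u1 u2 \<delta> p * slow 0 u1 u2 \<delta> p)
          + slow \<rho>0 \<rho>1 \<rho>2 \<delta> p * (slow 0 (pd1 u1) (pd1 u2) \<delta> p * slow 0 u1 u2 \<delta> p
              + slow 0 u1 u2 \<delta> p * slow 0 (pd1 u1) (pd1 u2) \<delta> p)
          + slow 0 (pd1 P1) (pd1 P2) \<delta> p)
      - \<delta> * (\<delta> * slow 0 (pd1 (pd1 u1)) (pd1 (pd1 u2)) \<delta> p)"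
    by (simp add: residual2_def m t xx pd1_add pd1_mult pd2_mult pd1_slow pd2_slow d dx differentiable_slow)
  then show ?thesis unfolding slow_def r_def rx_def rt_def v_def vx_def vt_def by algebra
qed

text \<open>Everything nonlinear in the perturbations begins at \<delta>^4; before it stand the
  equilibrium relation and its linearisation.\<close>

lemma residual5_ex:
  fixes \<rho>1 \<rho>2 R1 R2 :: "real \<times> real \<Rightarrow> real"
  defines "r \<equiv> \<rho>1 p + \<delta> * \<rho>2 p" and "w \<equiv> R1 p + \<delta> * R2 p"
  shows "residual5 X (ex \<rho>0 \<rho>1 \<rho>2) (ex R0 R1 R2) z =
    (1 - X + R0 ^ 3) * \<rho>0 - 1
    + \<delta>\<^sup>2 * ((1 - X + R0 ^ 3) * r + 3 * R0\<^sup>2 * \<rho>0 * w)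
    + \<delta> ^ 4 * (3 * R0\<^sup>2 * w * r + (\<rho>0 + \<delta>\<^sup>2 * r) * (3 * R0 * (w * w) + \<delta>\<^sup>2 * w * (w * w)))"
  unfolding residual5_def ex_eq_slow slow_def gm_z r_def w_def by algebra

text \<open>Over all of \<open>S\<close> the inner derivative is \<delta>^3 times a function of the
  slow variables, so the chain rule applies again and contributes the fourth \<delta>.\<close>

lemma mat_deriv_mat_deriv_ex:
  assumes "smooth_on S u1" "smooth_on S u2" "smooth_on S f1" "smooth_on S f2"
  shows "mat_deriv (ex 0 u1 u2) (mat_deriv (ex 0 u1 u2) (ex f0 f1 f2)) z
    = \<delta> ^ 4 * slow_mat_deriv2 a0 \<delta> u1 u2 f1 f2 p"
proof -
  let ?M = "mat_deriv (ex 0 u1 u2) (ex f0 f1 f2)"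
  let ?D = "slow_mat_deriv_pd a0 \<delta> u1 u2 f1 f2 p"
  note d = assms(1-4)[THEN smooth_on_imp_differentiable(1), OF S]
    assms(1-4)[THEN smooth_on_imp_differentiable(2), OF S]
    assms(1-4)[THEN smooth_on_imp_differentiable(3), OF S]
  have dM: "slow_mat_deriv a0 \<delta> u1 u2 f1 f2 differentiable (at p)"
    unfolding slow_mat_deriv_def by (simp add: d)
  have "pd1 (slow_mat_deriv a0 \<delta> u1 u2 f1 f2) p = ?D pd1"
    "pd2 (slow_mat_deriv a0 \<delta> u1 u2 f1 f2) p = ?D pd2"
    unfolding slow_mat_deriv_def
    by (simp_all add: slow_mat_deriv_pd_def d pd1_add pd2_add pd1_diff pd2_diff pd1_mult pd2_mult)
  moreover have "pd1 ?M z = \<delta> * pd1 (\<lambda>q. \<delta> ^ 3 * slow_mat_deriv a0 \<delta> u1 u2 f1 f2 q) p"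
    "pd2 ?M z = \<delta>\<^sup>2 * pd2 (\<lambda>q. \<delta> ^ 3 * slow_mat_deriv a0 \<delta> u1 u2 f1 f2 q) p
      - a0 * \<delta> * pd1 (\<lambda>q. \<delta> ^ 3 * slow_mat_deriv a0 \<delta> u1 u2 f1 f2 q) p"
    by (rule pd_z; simp add: mat_deriv_ex assms(3,4) dM)+
  ultimately have "mat_deriv (ex 0 u1 u2) ?M z
      = \<delta>\<^sup>2 * (\<delta> ^ 3 * ?D pd2) - a0 * \<delta> * (\<delta> ^ 3 * ?D pd1) + slow 0 u1 u2 \<delta> p * (\<delta> * (\<delta> ^ 3 * ?D pd1))"
    by (simp add: mat_deriv_def[of _ ?M] ex_eq_slow gm_z pd1_mult pd2_mult dM)
  then show ?thesis unfolding slow_def slow_mat_deriv2_def by algebra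
qed

text \<open>\<open>d\<close> and \<open>r\<close> still depend on \<delta>, so the \<delta>^3
  bracket cancels only to leading order; \<open>residual3_cancellation\<close> extracts the missing
  factor \<delta>.\<close>

lemma residual3_ex:
  fixes P0 R0 :: real
  assumes "smooth_on S u1" "smooth_on S u2" "smooth_on S R1" "smooth_on S R2"
  defines "d \<equiv> slow_mat_deriv a0 \<delta> u1 u2 R1 R2 p" and "r \<equiv> R0 + \<delta>\<^sup>2 * (R1 p + \<delta> * R2 p)"
  shows "residual3 (ex 0 u1 u2) (ex R0 R1 R2) (ex P0 P1 P2) (ex P0 Pb1 Pb2) z =
    \<delta>\<^sup>2 * (P1 p - Pb1 p) + \<delta> ^ 3 * (P2 p - Pb2 p + 4/3 * (d / r))
    + \<delta> ^ 4 * (r * slow_mat_deriv2 a0 \<delta> u1 u2 R1 R2 p + 3/2 * \<delta>\<^sup>2 * (d * d))"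
proof -
  have "ex R0 R1 R2 z = r" unfolding ex_eq_slow slow_def gm_z r_def by algebra
  moreover have "mat_deriv (ex 0 u1 u2) (ex R0 R1 R2) z = \<delta> ^ 3 * d"
    using mat_deriv_ex[OF assms(3,4), of z] S by (simp add: gm_z d_def)
  ultimately have "residual3 (ex 0 u1 u2) (ex R0 R1 R2) (ex P0 P1 P2) (ex P0 Pb1 Pb2) z =
    slow P0 P1 P2 \<delta> p - slow P0 Pb1 Pb2 \<delta> p + r * (\<delta> ^ 4 * slow_mat_deriv2 a0 \<delta> u1 u2 R1 R2 p)
    + 3/2 * (\<delta> ^ 3 * d)\<^sup>2 + 4/3 * (\<delta> ^ 3 * (d / r))"
    by (simp add: residual3_def mat_deriv_mat_deriv_ex[OF assms(1-4)] ex_eq_slow[of P0] gm_z)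
  then show ?thesis unfolding slow_def by algebra
qed

lemma residual4_ex:
  fixes P0 R0 :: real
  assumes "smooth_on S R1" "smooth_on S R2" "smooth_on S Pb1" "smooth_on S Pb2"
  defines "r \<equiv> R0 + \<delta>\<^sup>2 * (R1 p + \<delta> * R2 p)" and "\<pi> \<equiv> P0 + \<delta>\<^sup>2 * (Pb1 p + \<delta> * Pb2 p)"
  shows "residual4 \<gamma> P0 R0 T0 (ex 0 u1 u2) (ex R0 R1 R2) (ex P0 Pb1 Pb2) z =
    \<delta> ^ 3 * slow_mat_deriv a0 \<delta> u1 u2 Pb1 Pb2 p
    + 3 * \<gamma> * \<pi> * (\<delta> ^ 3 * slow_mat_deriv a0 \<delta> u1 u2 R1 R2 p / r)
    + 3 * (\<gamma> - 1) * (T0 / r) * (\<pi> * r ^ 3 / (P0 * R0 ^ 3) - 1)"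
proof -
  have "ex R0 R1 R2 z = r" "ex P0 Pb1 Pb2 z = \<pi>"
    unfolding ex_eq_slow slow_def gm_z r_def \<pi>_def by algebra+
  then show ?thesis
    using mat_deriv_ex[OF assms(1,2), of z] mat_deriv_ex[OF assms(3,4), of z] S
    by (simp add: residual4_def gm_z)
qed

end

section \<open>Cancellation of the lowest-order terms\<close>

text \<open>\<open>x\<close> stands for the \<xi>-derivative of \<open>R1\<close>. At \<delta> = 0
  the quotient \<open>d / r\<close> is \<open>- a0 * x / R0\<close>, which the relation for
  \<open>p2\<close> compensates; the deviation from this value carries a factor \<delta>.\<close>

lemma residual3_cancellation:
  fixes R0 :: real
  assumes "R0 \<noteq> 0" "r \<noteq> 0" "r = R0 + \<delta>\<^sup>2 * w" "d = \<delta> * e - a0 * x"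
    "p1 = b1" "p2 = b2 + 4 * a0 / (3 * R0) * x"
  shows "\<delta>\<^sup>2 * (p1 - b1) + \<delta> ^ 3 * (p2 - b2 + 4/3 * (d / r)) + \<delta> ^ 4 * g
    = \<delta> ^ 4 * (4/3 * (a0 / R0 * x * \<delta> * w + e) * inverse r + g)"
proof -
  have "4 * a0 / (3 * R0) * x + 4/3 * (d / r) = \<delta> * (4/3 * (a0 / R0 * x * \<delta> * w + e) * inverse r)"
    using assms(1,2) unfolding assms(4)
    by (simp add: field_simps) (simp add: assms(3) algebra_simps power2_eq_square)
  then show ?thesis unfolding assms(5,6) by algebra
qed

text \<open>\<open>w\<close> and \<open>y\<close> are the scaled perturbations of radius and bubble
  pressure, \<open>d\<close> and \<open>c\<close> their scaled material derivatives,
  \<open>x\<close> the \<xi>-derivative of \<open>R1\<close>; \<delta>^4 \<open>m\<close> is the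
  nonlinear part of the cube of \<open>r\<close>.\<close>

lemma residual4_cancellation:
  fixes P0 R0 T0 :: real
  assumes nz: "P0 \<noteq> 0" "R0 \<noteq> 0" "T0 \<noteq> 0" "r \<noteq> 0" and r: "r = R0 + \<delta>\<^sup>2 * w"
    and y: "y = - (3 * P0 / R0) * w + \<delta> * (a0 * P0\<^sup>2 / T0 * x)"
    and d: "d = \<delta> * e - a0 * x" and c: "c = \<delta> * b + 3 * a0 * P0 / R0 * x"
  defines "m \<equiv> 3 * R0 * (w * w) + \<delta>\<^sup>2 * (w * w * w)"
  shows "\<delta> ^ 3 * c + 3 * \<gamma> * (P0 + \<delta>\<^sup>2 * y) * (\<delta> ^ 3 * d / r)
      + 3 * (\<gamma> - 1) * (T0 / r) * ((P0 + \<delta>\<^sup>2 * y) * r ^ 3 / (P0 * R0 ^ 3) - 1)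
    = \<delta> ^ 4 * ((\<delta> * w * (3 * a0 * P0 / R0 * x) + r * b + 3 * \<gamma> * (P0 * e + \<delta> * y * d)
        + 3 * (\<gamma> - 1) * (T0 / (P0 * R0 ^ 3)) * (P0 * m + y * (3 * R0\<^sup>2 * w + \<delta>\<^sup>2 * m))) * inverse r)"
    (is "?L = \<delta> ^ 4 * (?N * inverse r)")
proof -
  let ?B = "(P0 + \<delta>\<^sup>2 * y) * r ^ 3 / (P0 * R0 ^ 3) - 1"
  let ?Q = "P0 * m + y * (3 * R0\<^sup>2 * w + \<delta>\<^sup>2 * m)"
  have "(P0 + \<delta>\<^sup>2 * y) * r ^ 3 - P0 * R0 ^ 3 = \<delta>\<^sup>2 * R0\<^sup>2 * (R0 * y + 3 * P0 * w) + \<delta> ^ 4 * ?Q"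
    unfolding r m_def by algebra
  \<comment> \<open>The part of \<open>y\<close> proportional to \<open>w\<close> removes the
    \<delta>^2 contribution of the heat term; the gradient part leaves one at \<delta>^3.\<close>
  also have "R0 * y + 3 * P0 * w = \<delta> * R0 * (a0 * P0\<^sup>2 / T0 * x)"
    using nz by (simp add: y algebra_simps)
  finally have "?B = (\<delta>\<^sup>2 * R0\<^sup>2 * (\<delta> * R0 * (a0 * P0\<^sup>2 / T0 * x)) + \<delta> ^ 4 * ?Q) / (P0 * R0 ^ 3)"
    using nz by (simp add: diff_divide_distrib[symmetric] divide_diff_eq_iff)
  then have "T0 * ?B = T0 * ((\<delta>\<^sup>2 * R0\<^sup>2 * (\<delta> * R0 * (a0 * P0\<^sup>2 / T0 * x)) + \<delta> ^ 4 * ?Q) / (P0 * R0 ^ 3))"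
    by simp
  also have "\<dots> = \<delta> ^ 3 * (a0 * P0 * x) + \<delta> ^ 4 * (T0 / (P0 * R0 ^ 3) * ?Q)"
    using nz by (simp add: field_simps power2_eq_square power3_eq_cube)
  finally have B: "T0 * ?B = \<delta> ^ 3 * (a0 * P0 * x) + \<delta> ^ 4 * (T0 / (P0 * R0 ^ 3) * ?Q)" .
  have C: "r * c = 3 * a0 * P0 * x + \<delta> * (r * b + \<delta> * w * (3 * a0 * P0 / R0 * x))"
    unfolding c using nz by (subst r) (simp add: r field_simps power2_eq_square)
  have "?L * r = \<delta> ^ 3 * (r * c) + 3 * \<gamma> * (P0 + \<delta>\<^sup>2 * y) * (\<delta> ^ 3 * d) + 3 * (\<gamma> - 1) * (T0 * ?B)"
    using nz(4) by (simp add: distrib_right)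
  \<comment> \<open>The \<delta>^3 terms are \<open>a0 * P0 * x\<close> times 3 - 3\<gamma> +
    3(\<gamma> - 1) = 0.\<close>
  also have "\<dots> = \<delta> ^ 4 * ?N"
    unfolding B C d by algebra
  finally show ?thesis
    using nz(4) by (simp add: field_simps)
qed

theorem proposition3p2:
  fixes \<alpha> \<beta> k q P0 R0 T0 \<gamma> X s \<rho>0 a0 A :: real
    and J :: "real set"
    and \<rho>1 \<rho>2 u1 u2 R1 R2 P1 P2 Pb1 Pb2 :: "real \<times> real \<Rightarrow> real"
    and \<rho> u R P Pb :: "real \<Rightarrow> real \<times> real \<Rightarrow> real"
  assumes "\<alpha> > 0" and "\<beta> = \<alpha>" and "k = \<alpha>" and "q = 2 * \<alpha>"
    and "P0 > 0" and "R0 > 0" and "T0 > 0" and "\<gamma> > 1" and "0 < X" and "X < 1"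
    and "s = R0 ^ 3 - X + 1" and "\<rho>0 = 1 / s"
    and "a0 = R0 powr (- 3/2) * P0 powr (1/2) * s"
    and "A = ((P0\<^sup>2 * R0 + 4/3 * T0) * (1 - X) + P0\<^sup>2 * R0 ^ 4 + 13/3 * R0 ^ 3 * T0) * s
             / (6 * R0 ^ 3 * T0)"
    and "open J" and "is_interval J"
    and "\<forall>f \<in> {\<rho>1, \<rho>2, u1, u2, R1, R2, P1, P2, Pb1, Pb2}. smooth_on (UNIV \<times> J) f"
    and "\<forall>p \<in> UNIV \<times> J. pd2 \<rho>1 p = A * pd1 (pd1 \<rho>1) p"
    and "\<forall>p \<in> UNIV \<times> J. u1 p = a0 / \<rho>0 * \<rho>1 p"
    and "\<forall>p \<in> UNIV \<times> J. R1 p = - (s\<^sup>2 / (3 * R0\<^sup>2)) * \<rho>1 p"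
    and "\<forall>p \<in> UNIV \<times> J. Pb1 p = - (3 * P0 / R0) * R1 p"
    and "\<forall>p \<in> UNIV \<times> J. P1 p = Pb1 p"
    and "\<forall>p \<in> UNIV \<times> J. pd1 u2 p = a0 / \<rho>0 * pd1 \<rho>2 p - 1 / \<rho>0 * pd2 \<rho>1 p"
    and "\<forall>p \<in> UNIV \<times> J. P2 p = Pb2 p + 4 * a0 / (3 * R0) * pd1 R1 p"
    and "\<forall>p \<in> UNIV \<times> J. Pb2 p = - (3 * P0 / R0) * R2 p + a0 * P0\<^sup>2 / T0 * pd1 R1 p"
    and "\<forall>p \<in> UNIV \<times> J. R2 p = - (s\<^sup>2 / (3 * R0\<^sup>2)) * \<rho>2 p"
    and "\<rho> = gm_expansion \<alpha> \<beta> a0 q k \<rho>0 \<rho>1 \<rho>2"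
    and "u = gm_expansion \<alpha> \<beta> a0 q k 0 u1 u2"
    and "R = gm_expansion \<alpha> \<beta> a0 q k R0 R1 R2"
    and "P = gm_expansion \<alpha> \<beta> a0 q k P0 P1 P2"
    and "Pb = gm_expansion \<alpha> \<beta> a0 q k P0 Pb1 Pb2"
  shows "\<forall>p \<in> UNIV \<times> J.
      (\<forall>E \<in> {\<lambda>\<epsilon>. residual1 (\<rho> \<epsilon>) (u \<epsilon>) (gm_inv \<alpha> \<beta> a0 \<epsilon> p),
              \<lambda>\<epsilon>. residual2 (\<rho> \<epsilon>) (u \<epsilon>) (P \<epsilon>) (gm_inv \<alpha> \<beta> a0 \<epsilon> p)}.
         (\<exists>c. has_powr_expansion \<alpha> E c \<and> c (\<alpha> + q) = 0 \<and> c (\<alpha> + q + k) = 0) \<and>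
         E \<in> O[at_right 0](\<lambda>\<epsilon>. \<epsilon> powr (5 * \<alpha>))) \<and>
      (\<forall>E \<in> {\<lambda>\<epsilon>. residual3 (u \<epsilon>) (R \<epsilon>) (P \<epsilon>) (Pb \<epsilon>) (gm_inv \<alpha> \<beta> a0 \<epsilon> p),
              \<lambda>\<epsilon>. residual4 \<gamma> P0 R0 T0 (u \<epsilon>) (R \<epsilon>) (Pb \<epsilon>) (gm_inv \<alpha> \<beta> a0 \<epsilon> p),
              \<lambda>\<epsilon>. residual5 X (\<rho> \<epsilon>) (R \<epsilon>) (gm_inv \<alpha> \<beta> a0 \<epsilon> p)}.
         (\<exists>c. has_powr_expansion \<alpha> E c \<and> c q = 0 \<and> c (q + k) = 0) \<and>
         E \<in> O[at_right 0](\<lambda>\<epsilon>. \<epsilon> powr (4 * \<alpha>)))"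
proof
  fix p :: "real \<times> real" assume p: "p \<in> UNIV \<times> J"
  let ?S = "(UNIV :: real set) \<times> J"
  \<comment> \<open>All coefficients below index m vanish: the two named in the conclusion and those
    of still lower order.\<close>
  let ?C = "\<lambda>m E. (\<exists>c. has_powr_expansion \<alpha> E c \<and> (\<forall>n<m. c (real n * \<alpha>) = 0))
    \<and> E \<in> O[at_right 0](\<lambda>\<epsilon>. \<epsilon> powr (real m * \<alpha>))"
  have S: "open ?S" using \<open>open J\<close> by (simp add: open_Times)
  have expansionI: "?C m E" if "\<exists>H. h has_fps_expansion H"
    "eventually (\<lambda>\<epsilon>. E \<epsilon> = (\<epsilon> powr \<alpha>) ^ m * h (\<epsilon> powr \<alpha>)) (at_right 0)" for m E h
    using that(1) has_powr_expansion_leading_zeros[OF \<open>\<alpha> > 0\<close> _ that(2)] by metis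
  have smooth: "smooth_on ?S \<rho>1" "smooth_on ?S \<rho>2" "smooth_on ?S u1" "smooth_on ?S u2"
    "smooth_on ?S R1" "smooth_on ?S R2" "smooth_on ?S P1" "smooth_on ?S P2"
    "smooth_on ?S Pb1" "smooth_on ?S Pb2"
    using assms(17) by blast+
  note d = smooth[THEN smooth_on_imp_differentiable(1), OF S]
  note dx = smooth[THEN smooth_on_imp_differentiable(2), OF S]
  note cmult1 = pd1_cmult_open[OF S] and cmult2 = pd2_cmult_open[OF S]
  \<comment> \<open>The ratio of radius to density perturbation at both orders, from linearising (1
    - X + R^3) \<rho> = 1 at the equilibrium.\<close>
  define \<kappa> where "\<kappa> = - (s\<^sup>2 / (3 * R0\<^sup>2))"
  have s: "s > 0"
    unfolding assms(11) using zero_less_power[OF \<open>R0 > 0\<close>, of 3] \<open>X < 1\<close> by linarith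
  \<comment> \<open>Squaring removes the fractional powers in the wave speed. This identity balances
    pressure gradient against inertia at order \<delta>^3 of the second residual.\<close>
  have a0: "a0\<^sup>2 * R0 ^ 3 = P0 * s\<^sup>2"
  proof -
    have "(R0 powr (- 3/2))\<^sup>2 = R0 powr (- 3)" "(P0 powr (1/2))\<^sup>2 = P0"
      using \<open>P0 > 0\<close> by (simp_all add: power2_eq_square flip: powr_add)
    moreover have "R0 powr (- 3) * R0 ^ 3 = 1"
      using \<open>R0 > 0\<close> by (simp add: powr_minus powr_numeral)
    moreover have "(a * c * s)\<^sup>2 * R0 ^ 3 = P0 * s\<^sup>2"
      if "a\<^sup>2 = b" "c\<^sup>2 = P0" "b * R0 ^ 3 = 1" for a b c
    proof -
      have "(a * c * s)\<^sup>2 * R0 ^ 3 = a\<^sup>2 * c\<^sup>2 * s\<^sup>2 * R0 ^ 3"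
        by (simp add: power_mult_distrib)
      also have "\<dots> = P0 * s\<^sup>2 * (b * R0 ^ 3)"
        using that(1,2) by simp
      finally show ?thesis using that(3) by simp
    qed
    ultimately show ?thesis
      unfolding assms(13) by blast
  qed
  have nz: "P0 \<noteq> 0" "R0 \<noteq> 0" "T0 \<noteq> 0" "s \<noteq> 0" using assms(5-7) s by auto

  \<comment> \<open>Relations between the coefficient functions and their derivatives\<close>
  have u1: "u1 q = a0 * s * \<rho>1 q" and R1: "R1 q = \<kappa> * \<rho>1 q" and R2: "R2 q = \<kappa> * \<rho>2 q"
    and Pb1: "Pb1 q = - (3 * P0 / R0) * R1 q" and P1: "P1 q = - (3 * P0 / R0) * R1 q"
    and Pb2: "Pb2 q = - (3 * P0 / R0) * R2 q + a0 * P0\<^sup>2 / T0 * pd1 R1 q"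
    and P2: "P2 q = 1 * Pb2 q + 4 * a0 / (3 * R0) * pd1 R1 q"
    and u2x: "pd1 u2 q = a0 * s * pd1 \<rho>2 q - s * pd2 \<rho>1 q"
    and \<rho>1t: "pd2 \<rho>1 q = A * pd1 (pd1 \<rho>1) q" if "q \<in> ?S" for q
    using assms(18-26)[THEN bspec, OF that] by (simp_all add: \<kappa>_def assms(12))
  \<comment> \<open>Proved at all points of the open set, as is \<open>R1x\<close>, because both are
    differentiated once more.\<close>
  have u1x: "pd1 u1 q = a0 * s * pd1 \<rho>1 q" if "q \<in> ?S" for q
    by (rule cmult1[OF that], erule u1, rule d(1)[OF that])
  have R1x: "pd1 R1 q = \<kappa> * pd1 \<rho>1 q" if "q \<in> ?S" for q
    by (rule cmult1[OF that], erule R1, rule d(1)[OF that])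
  have u1xx: "pd1 (pd1 u1) p = a0 * s * pd1 (pd1 \<rho>1) p"
    by (rule cmult1[OF p], erule u1x, rule dx(1)[OF p])
  have R1xx: "pd1 (pd1 R1) p = \<kappa> * pd1 (pd1 \<rho>1) p"
    by (rule cmult1[OF p], erule R1x, rule dx(1)[OF p])
  have R2x: "pd1 R2 p = \<kappa> * pd1 \<rho>2 p"
    by (rule cmult1[OF p], erule R2, rule d(2)[OF p])
  have Pb1x: "pd1 Pb1 p = - (3 * P0 / R0) * pd1 R1 p"
    by (rule cmult1[OF p], erule Pb1, rule d(5)[OF p])
  have P1x: "pd1 P1 p = - (3 * P0 / R0) * pd1 R1 p"
    by (rule cmult1[OF p], erule P1, rule d(5)[OF p])
  have u1t: "pd2 u1 p = a0 * s * pd2 \<rho>1 p"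
    by (rule cmult2[OF p], erule u1, rule d(1)[OF p])
  have Pb2x: "pd1 Pb2 p = - (3 * P0 / R0) * pd1 R2 p + a0 * P0\<^sup>2 / T0 * pd1 (pd1 R1) p"
    by (rule pd1_lincomb_open[OF S p], erule Pb2, rule d(6)[OF p], rule dx(5)[OF p])
  \<comment> \<open>The factor 1 gives the relation the linear-combination shape of
    \<open>pd1_lincomb_open\<close>.\<close>
  have P2x: "pd1 P2 p = 1 * pd1 Pb2 p + 4 * a0 / (3 * R0) * pd1 (pd1 R1) p"
    by (rule pd1_lincomb_open[OF S p], erule P2, rule d(10)[OF p], rule dx(5)[OF p])

  \<comment> \<open>The radius as denominator and the leading part of material derivatives\<close>
  let ?z = "\<lambda>\<epsilon>. gm_inv \<alpha> \<alpha> a0 \<epsilon> p"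
  note fields = assms(27-31)[unfolded \<open>\<beta> = \<alpha>\<close> \<open>k = \<alpha>\<close> \<open>q = 2 * \<alpha>\<close>]
  have pos: "eventually (\<lambda>\<epsilon>::real. \<epsilon> > 0) (at_right 0)" by (rule eventually_at_right_less)
  have lim: "((\<lambda>\<epsilon>. \<epsilon> powr \<alpha>) \<longlongrightarrow> 0) (at_right 0)"
    using \<open>\<alpha> > 0\<close>
    by (intro tendsto_zero_powrI[OF tendsto_ident_at tendsto_const] eventually_mono[OF pos]) auto
  define r where "r = (\<lambda>\<delta>. R0 + \<delta>\<^sup>2 * (R1 p + \<delta> * R2 p))"
  define G where "G = fps_const R0 + fps_X\<^sup>2 * (fps_const (R1 p) + fps_X * fps_const (R2 p))"
  have r_fps: "r has_fps_expansion G"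
    unfolding r_def G_def by (intro fps_expansion_intros)
  moreover have "fps_nth G 0 \<noteq> 0" using nz by (simp add: G_def)
  ultimately have ir: "(\<lambda>\<delta>. inverse (r \<delta>)) has_fps_expansion inverse G"
    by (rule has_fps_expansion_inverse)
  have "((\<lambda>\<epsilon>. r (\<epsilon> powr \<alpha>)) \<longlongrightarrow> R0 + 0\<^sup>2 * (R1 p + 0 * R2 p)) (at_right 0)"
    unfolding r_def by (intro tendsto_intros lim)
  then have r0: "eventually (\<lambda>\<epsilon>. r (\<epsilon> powr \<alpha>) \<noteq> 0) (at_right 0)"
    by (rule tendsto_imp_eventually_ne) (use nz in simp)
  \<comment> \<open>What remains of the scaled material derivative after splitting off
    \<open>- a0 * pd1 f1 p\<close> and dividing by \<delta>.\<close>
  define e where "e = (\<lambda>f1 f2 \<delta>. \<delta> * (u1 p + \<delta> * u2 p) * (pd1 f1 p + \<delta> * pd1 f2 p) - a0 * pd1 f2 p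
    + pd2 f1 p + \<delta> * pd2 f2 p)"
  have slow_e: "slow_mat_deriv a0 \<delta> u1 u2 f1 f2 p = \<delta> * e f1 f2 \<delta> - a0 * pd1 f1 p" for f1 f2 \<delta>
    unfolding slow_mat_deriv_def e_def by algebra

  \<comment> \<open>These rules build the series witness \<open>H\<close> along the shape of each
    remainder. The only powers covered are those of \<delta>, so squares of other \<delta>-dependent
    terms are written as products.\<close>
  note poly = has_fps_expansion_const has_fps_expansion_fps_X has_fps_expansion_fps_X_power
    has_fps_expansion_add has_fps_expansion_diff has_fps_expansion_mult

  \<comment> \<open>Conservation of mass\<close>
  define h1 where "h1 = (\<lambda>\<delta>. pd2 \<rho>2 p + (pd1 \<rho>1 p + \<delta> * pd1 \<rho>2 p) * (u1 p + \<delta> * u2 p)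
    + (\<rho>1 p + \<delta> * \<rho>2 p) * (pd1 u1 p + \<delta> * pd1 u2 p))"
  have "\<exists>H. h1 has_fps_expansion H"
    unfolding h1_def by (rule exI) (rule poly)+
  moreover have "residual1 (\<rho> \<epsilon>) (u \<epsilon>) (?z \<epsilon>) = (\<epsilon> powr \<alpha>) ^ 5 * h1 (\<epsilon> powr \<alpha>)" if "\<epsilon> > 0" for \<epsilon>
  proof -
    have "\<rho>0 * pd1 u1 p - a0 * pd1 \<rho>1 p = 0" "\<rho>0 * pd1 u2 p - a0 * pd1 \<rho>2 p + pd2 \<rho>1 p = 0"
      using nz p by (simp_all add: u1x u2x assms(12) diff_divide_distrib)
    then show ?thesis
      unfolding fields residual1_ex[OF S p that smooth(1-4)] h1_def by simp
  qed
  then have "eventually (\<lambda>\<epsilon>. residual1 (\<rho> \<epsilon>) (u \<epsilon>) (?z \<epsilon>) = (\<epsilon> powr \<alpha>) ^ 5 * h1 (\<epsilon> powr \<alpha>)) (at_right 0)"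
    by (rule eventually_mono[OF pos])
  ultimately have E1: "?C 5 (\<lambda>\<epsilon>. residual1 (\<rho> \<epsilon>) (u \<epsilon>) (?z \<epsilon>))"
    by (rule expansionI)

  \<comment> \<open>Momentum balance and the diffusion coefficient\<close>
  have 1: "pd1 P1 p - a0 * \<rho>0 * pd1 u1 p = 0"
    using nz p a0 by (simp add: P1x R1x u1x \<kappa>_def assms(12) field_simps power2_eq_square power3_eq_cube)
  have A: "2 * a0 * A = a0 * s - \<kappa> * (a0 * P0\<^sup>2 / T0 + 4 * a0 / (3 * R0))"
  proof -
    \<comment> \<open>Splitting 13/3 as 3 + 4/3 lets \<open>1 - X + R0 ^ 3\<close> be collected into
      \<open>s\<close>.\<close>
    have num: "(P0\<^sup>2 * R0 + 4/3 * T0) * (1 - X) + P0\<^sup>2 * R0 ^ 4 + 13/3 * R0 ^ 3 * T0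
        = 3 * R0 ^ 3 * T0 + s * (P0\<^sup>2 * R0 + 4/3 * T0)"
      unfolding assms(11) by algebra
    show ?thesis
      unfolding assms(14) num \<kappa>_def using nz
      by (simp add: field_simps power2_eq_square power3_eq_cube)
  qed
  have a0_\<kappa>: "a0\<^sup>2 = - (3 * P0 / R0) * \<kappa>"
    using nz a0 by (simp add: \<kappa>_def field_simps power2_eq_square power3_eq_cube)
  have "pd1 P2 p = a0\<^sup>2 * pd1 \<rho>2 p + \<kappa> * (a0 * P0\<^sup>2 / T0 + 4 * a0 / (3 * R0)) * pd1 (pd1 \<rho>1) p"
    unfolding P2x Pb2x R2x R1xx a0_\<kappa> by (simp add: algebra_simps)
  moreover have "a0 * \<rho>0 * pd1 u2 p = a0\<^sup>2 * pd1 \<rho>2 p - a0 * pd2 \<rho>1 p"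
    "\<rho>0 * pd2 u1 p = a0 * pd2 \<rho>1 p"
    using nz p by (simp_all add: u2x u1t assms(12) field_simps power2_eq_square)
  \<comment> \<open>The \<open>\<rho>2\<close> terms cancel. The time derivative of
    \<open>\<rho>1\<close> enters twice, through \<open>u2\<close> and through \<open>u1\<close>,
    hence the factor 2 in the identity for \<open>A\<close>; the heat equation turns it into a
    second \<xi>-derivative.\<close>
  ultimately have 2: "pd1 P2 p - a0 * \<rho>0 * pd1 u2 p + \<rho>0 * pd2 u1 p - pd1 (pd1 u1) p = 0"
    using A unfolding u1xx \<rho>1t[OF p] by algebra
  define h2 where "h2 = (\<lambda>\<delta>. \<rho>0 * pd2 u2 p - pd1 (pd1 u2) p
    - a0 * ((pd1 \<rho>1 p + \<delta> * pd1 \<rho>2 p) * (u1 p + \<delta> * u2 p) + (\<rho>1 p + \<delta> * \<rho>2 p) * (pd1 u1 p + \<delta> * pd1 u2 p))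
    + \<delta> * ((pd2 \<rho>1 p + \<delta> * pd2 \<rho>2 p) * (u1 p + \<delta> * u2 p) + (\<rho>1 p + \<delta> * \<rho>2 p) * (pd2 u1 p + \<delta> * pd2 u2 p))
    + \<delta>\<^sup>2 * (pd1 \<rho>1 p + \<delta> * pd1 \<rho>2 p) * ((u1 p + \<delta> * u2 p) * (u1 p + \<delta> * u2 p))
    + 2 * (\<rho>0 + \<delta>\<^sup>2 * (\<rho>1 p + \<delta> * \<rho>2 p)) * (u1 p + \<delta> * u2 p) * (pd1 u1 p + \<delta> * pd1 u2 p))"
  have "\<exists>H. h2 has_fps_expansion H"
    unfolding h2_def by (rule exI) (rule poly)+
  moreover have "residual2 (\<rho> \<epsilon>) (u \<epsilon>) (P \<epsilon>) (?z \<epsilon>) = (\<epsilon> powr \<alpha>) ^ 5 * h2 (\<epsilon> powr \<alpha>)" if "\<epsilon> > 0" for \<epsilon>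
    unfolding fields residual2_ex[OF S p that smooth(1-4,7,8)] 1 2 h2_def by simp
  then have "eventually (\<lambda>\<epsilon>. residual2 (\<rho> \<epsilon>) (u \<epsilon>) (P \<epsilon>) (?z \<epsilon>) = (\<epsilon> powr \<alpha>) ^ 5 * h2 (\<epsilon> powr \<alpha>)) (at_right 0)"
    by (rule eventually_mono[OF pos])
  ultimately have E2: "?C 5 (\<lambda>\<epsilon>. residual2 (\<rho> \<epsilon>) (u \<epsilon>) (P \<epsilon>) (?z \<epsilon>))"
    by (rule expansionI)

  \<comment> \<open>Equation of bubble motion\<close>
  define h3 where "h3 = (\<lambda>\<delta>.
    4/3 * (a0 / R0 * pd1 R1 p * \<delta> * (R1 p + \<delta> * R2 p) + e R1 R2 \<delta>) * inverse (r \<delta>)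
    + (r \<delta> * slow_mat_deriv2 a0 \<delta> u1 u2 R1 R2 p
       + 3/2 * \<delta>\<^sup>2 * (slow_mat_deriv a0 \<delta> u1 u2 R1 R2 p * slow_mat_deriv a0 \<delta> u1 u2 R1 R2 p)))"
  have "\<exists>H. h3 has_fps_expansion H"
    unfolding h3_def slow_mat_deriv2_def slow_mat_deriv_pd_def slow_mat_deriv_def e_def
    by (rule exI) (rule ir r_fps poly)+
  moreover have "eventually (\<lambda>\<epsilon>. residual3 (u \<epsilon>) (R \<epsilon>) (P \<epsilon>) (Pb \<epsilon>) (?z \<epsilon>)
      = (\<epsilon> powr \<alpha>) ^ 4 * h3 (\<epsilon> powr \<alpha>)) (at_right 0)"
    using pos r0
  proof eventually_elim
    case (elim \<epsilon>)
    \<comment> \<open>\<open>h3\<close> is the cofactor of \<delta>^4 in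
      \<open>residual3_cancellation\<close> for \<open>x = pd1 R1 p\<close> and remainder
      \<open>e R1 R2\<close>.\<close>
    show ?case
      unfolding fields residual3_ex[OF S p elim(1) smooth(3-6)] h3_def fun_cong[OF r_def, symmetric]
      by (rule residual3_cancellation[OF nz(2) elim(2)]) (simp_all add: r_def slow_e P1 P2 Pb1 p)
  qed
  ultimately have E3: "?C 4 (\<lambda>\<epsilon>. residual3 (u \<epsilon>) (R \<epsilon>) (P \<epsilon>) (Pb \<epsilon>) (?z \<epsilon>))"
    by (rule expansionI)

  \<comment> \<open>Bubble pressure and heat exchange\<close>
  define w where "w = (\<lambda>\<delta>. R1 p + \<delta> * R2 p)"
  define y where "y = (\<lambda>\<delta>. Pb1 p + \<delta> * Pb2 p)"
  define h4 where "h4 = (\<lambda>\<delta>. (\<delta> * w \<delta> * (3 * a0 * P0 / R0 * pd1 R1 p) + r \<delta> * e Pb1 Pb2 \<delta>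
    + 3 * \<gamma> * (P0 * e R1 R2 \<delta> + \<delta> * y \<delta> * slow_mat_deriv a0 \<delta> u1 u2 R1 R2 p)
    + 3 * (\<gamma> - 1) * (T0 / (P0 * R0 ^ 3)) * (P0 * (3 * R0 * (w \<delta> * w \<delta>) + \<delta>\<^sup>2 * (w \<delta> * w \<delta> * w \<delta>))
       + y \<delta> * (3 * R0\<^sup>2 * w \<delta> + \<delta>\<^sup>2 * (3 * R0 * (w \<delta> * w \<delta>) + \<delta>\<^sup>2 * (w \<delta> * w \<delta> * w \<delta>))))) * inverse (r \<delta>))"
  have "\<exists>H. h4 has_fps_expansion H"
    unfolding h4_def slow_mat_deriv_def e_def w_def y_def
    by (rule exI) (rule ir r_fps poly)+
  moreover have "eventually (\<lambda>\<epsilon>. residual4 \<gamma> P0 R0 T0 (u \<epsilon>) (R \<epsilon>) (Pb \<epsilon>) (?z \<epsilon>)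
      = (\<epsilon> powr \<alpha>) ^ 4 * h4 (\<epsilon> powr \<alpha>)) (at_right 0)"
    using pos r0
  proof eventually_elim
    case (elim \<epsilon>)
    \<comment> \<open>The relations for \<open>Pb1\<close> and \<open>Pb2\<close> merge into one
      identity between the scaled perturbations.\<close>
    have yw: "y (\<epsilon> powr \<alpha>) = - (3 * P0 / R0) * w (\<epsilon> powr \<alpha>) + \<epsilon> powr \<alpha> * (a0 * P0\<^sup>2 / T0 * pd1 R1 p)"
      unfolding y_def w_def Pb1[OF p] Pb2[OF p] by algebra
    show ?case
      unfolding fields residual4_ex[OF S p elim(1) smooth(5,6,9,10)] h4_def fun_cong[OF r_def, symmetric]
        fun_cong[OF y_def, symmetric]
      by (rule residual4_cancellation[OF nz(1-3) elim(2) _ yw]) (simp_all add: r_def w_def slow_e Pb1x)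
  qed
  ultimately have E4: "?C 4 (\<lambda>\<epsilon>. residual4 \<gamma> P0 R0 T0 (u \<epsilon>) (R \<epsilon>) (Pb \<epsilon>) (?z \<epsilon>))"
    by (rule expansionI)

  \<comment> \<open>Relation between density and bubble radius\<close>
  define h5 where "h5 = (\<lambda>\<delta>. 3 * R0\<^sup>2 * w \<delta> * (\<rho>1 p + \<delta> * \<rho>2 p)
    + (\<rho>0 + \<delta>\<^sup>2 * (\<rho>1 p + \<delta> * \<rho>2 p)) * (3 * R0 * (w \<delta> * w \<delta>) + \<delta>\<^sup>2 * w \<delta> * (w \<delta> * w \<delta>)))"
  have "\<exists>H. h5 has_fps_expansion H"
    unfolding h5_def w_def by (rule exI) (rule poly)+
  moreover have "residual5 X (\<rho> \<epsilon>) (R \<epsilon>) (?z \<epsilon>) = (\<epsilon> powr \<alpha>) ^ 4 * h5 (\<epsilon> powr \<alpha>)" if "\<epsilon> > 0" for \<epsilon>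
  proof -
    \<comment> \<open>Since both orders share the ratio \<kappa>, the linearised bracket vanishes
      for every \<delta>, which disposes of \<delta>^2 and \<delta>^3 together.\<close>
    have w: "w \<delta> = \<kappa> * (\<rho>1 p + \<delta> * \<rho>2 p)" for \<delta>
      by (simp add: w_def R1 R2 p algebra_simps)
    have "s * x + 3 * R0\<^sup>2 * \<rho>0 * (\<kappa> * x) = 0" for x
      using nz by (simp add: \<kappa>_def assms(12) power2_eq_square)
    then have "s * (\<rho>1 p + \<delta> * \<rho>2 p) + 3 * R0\<^sup>2 * \<rho>0 * w \<delta> = 0" for \<delta>
      unfolding w .
    moreover have "1 - X + R0 ^ 3 = s" by (simp add: assms(11))
    moreover have "s * \<rho>0 = 1" using nz by (simp add: assms(12))
    ultimately show ?thesis
      unfolding fields residual5_ex[OF S p that] h5_def by (simp add: w_def)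
  qed
  then have "eventually (\<lambda>\<epsilon>. residual5 X (\<rho> \<epsilon>) (R \<epsilon>) (?z \<epsilon>) = (\<epsilon> powr \<alpha>) ^ 4 * h5 (\<epsilon> powr \<alpha>)) (at_right 0)"
    by (rule eventually_mono[OF pos])
  ultimately have E5: "?C 4 (\<lambda>\<epsilon>. residual5 X (\<rho> \<epsilon>) (R \<epsilon>) (?z \<epsilon>))"
    by (rule expansionI)

  \<comment> \<open>Reading off the required coefficients\<close>
  have coeffs: "(\<exists>c. has_powr_expansion \<alpha> E c \<and> c (real i * \<alpha>) = 0 \<and> c (real j * \<alpha>) = 0)
      \<and> E \<in> O[at_right 0](\<lambda>\<epsilon>. \<epsilon> powr (real m * \<alpha>))" if "?C m E" "i < m" "j < m" for m E i j
    using that by blast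
  show "(\<forall>E \<in> {\<lambda>\<epsilon>. residual1 (\<rho> \<epsilon>) (u \<epsilon>) (gm_inv \<alpha> \<beta> a0 \<epsilon> p),
              \<lambda>\<epsilon>. residual2 (\<rho> \<epsilon>) (u \<epsilon>) (P \<epsilon>) (gm_inv \<alpha> \<beta> a0 \<epsilon> p)}.
         (\<exists>c. has_powr_expansion \<alpha> E c \<and> c (\<alpha> + q) = 0 \<and> c (\<alpha> + q + k) = 0) \<and>
         E \<in> O[at_right 0](\<lambda>\<epsilon>. \<epsilon> powr (5 * \<alpha>))) \<and>
      (\<forall>E \<in> {\<lambda>\<epsilon>. residual3 (u \<epsilon>) (R \<epsilon>) (P \<epsilon>) (Pb \<epsilon>) (gm_inv \<alpha> \<beta> a0 \<epsilon> p),
              \<lambda>\<epsilon>. residual4 \<gamma> P0 R0 T0 (u \<epsilon>) (R \<epsilon>) (Pb \<epsilon>) (gm_inv \<alpha> \<beta> a0 \<epsilon> p),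
              \<lambda>\<epsilon>. residual5 X (\<rho> \<epsilon>) (R \<epsilon>) (gm_inv \<alpha> \<beta> a0 \<epsilon> p)}.
         (\<exists>c. has_powr_expansion \<alpha> E c \<and> c q = 0 \<and> c (q + k) = 0) \<and>
         E \<in> O[at_right 0](\<lambda>\<epsilon>. \<epsilon> powr (4 * \<alpha>)))"
    \<comment> \<open>In units of \<alpha>, \<alpha> + q and \<alpha> + q + k are 3 and 4, while q
      and q + k are 2 and 3.\<close>
    using coeffs[OF E1, of 3 4] coeffs[OF E2, of 3 4]
      coeffs[OF E3, of 2 3] coeffs[OF E4, of 2 3] coeffs[OF E5, of 2 3]
    unfolding \<open>\<beta> = \<alpha>\<close> \<open>q = 2 * \<alpha>\<close> \<open>k = \<alpha>\<close> by simp
qed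

end
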